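(* Let $\theta>0$. Suppose that the backward Riccati recursion (given in the context) generating $P_t,\eta_t,\tilde P_{t+1},\tilde H_t,S_t$ is well-defined for $t=0,\ldots,N-1$, that $S_t\succ0$ for all $t=0,\ldots,N-1$, and that $\Xi_t:=\Sigma_t^{-1}-2\theta\tilde H_t\succ0$ for all $t=0,\ldots,N-1$. Then the zero-sum dynamic game $$\hat J^*=\min_{\hat u_{0:N-1}}\ \max_{(v_{0:N-1},\,d_{0:N-1})}\ L_0(x_{0:N},\hat u_{0:N-1}+d_{0:N-1})-\frac{1}{2\theta}\sum_{k=0}^{N-1}\left(v_k^\top W_k^{-1}v_k+d_k^\top\Sigma_k^{-1}d_k\right)$$ subject to $x_{t+1}=A_tx_t+B_t(\hat u_t+d_t)+v_t$, $x_0=x^{\mathsf{ini}}$, admits a saddle point $(\hat u^*_{0:N-1},v^*_{0:N-1},d^*_{0:N-1})$, where the controller's optimal strategy is $$\hat u_t^*=\tilde K_tx_t,\qquad \tilde K_t=-\left(R_t+B_t^\top\tilde P_{t+1}B_t\right)^{-1}B_t^\top\tilde P_{t+1}A_t,$$ while the adversary's best responses to an arbitrary $\hat u_t$ are $$d_t^*=2\theta\,\Xi_t^{-1}\tilde H_t(\hat u_t-\tilde K_tx_t),\qquad v_t^*=2\theta\,S_t^{-1}P_{t+1}\left(A_tx_t+B_t(\hat u_t+d_t^* )\right).$$ In particular, $d_t^*=0$ whenever $\hat u_t=\hat u_t^*$. Moreover, the controller's worst-case cost-to-go function satisfies $\hat V_t(x)=x^\top P_tx$ for all $x\in\mathbb{R}^n$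 and $t=0,\ldots,N$.
   Context: Notation: $|A|$ is the determinant of a square matrix $A$; $\succ,\succeq$ denote the Loewner order on symmetric matrices; $v_{0:N}=[v_0^\top,\ldots,v_N^\top]^\top$. Data: positive integers $n,m,N$; matrices $A_t\in\mathbb{R}^{n\times n}$, $B_t\in\mathbb{R}^{n\times m}$, symmetric $W_t\in\mathbb{R}^{n\times n}$ with $W_t\succ0$, $\Sigma_t\in\mathbb{R}^{m\times m}$ with $\Sigma_t\succ 0$, $R_t\in\mathbb{R}^{m\times m}$ with $R_t\succ0$ ($t=0,\ldots,N-1$), and $Q_t\in\mathbb{R}^{n\times n}$ with $Q_t\succeq0$ ($t=0,\ldots,N$); an initial state $x^{\mathsf{ini}}\in\mathbb{R}^n$. Cost: for $t=0,\ldots,N-1$, $L_t(x_{t:N},u_{t:N-1}):=x_N^\top Q_Nx_N+\sum_{k=t}^{N-1}\left(x_k^\top Q_kx_k+u_k^\top R_ku_k\right)$. Game: the controller chooses $\hat u_t\in\mathbb{R}^m$ to minimize, and the adversary chooses $v_t\in\mathbb{R}^n$, $d_t\in\mathbb{R}^m$ to maximize. Play is sequential and closed-loop: $\hat u_t$ may depend on the state history $x_0,\ldots,x_t$, and $(v_t,d_t)$ may depend on the state history $x_0,\ldots,x_t$ and on $\hat u_t$. A saddle point $(\hat u^*,v^*,d^* )$ is a triple of such strategies for which replacing $(v^*_{0:N-1},d^*_{0:N-1})$ (keeping $\hat u^*$) cannot increase the game objective, and replacing $\hat u^*_{0:N-1}$ alone (keeping the adversary's response strategies) cannot decrease it. Worst-case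 cost-to-go: $\hat V_N(x)=x^\top Q_Nx$ and, for $t=0,\ldots,N-1$, with $x_t=x$ and the same dynamics and information pattern, $$\hat V_t(x)=\min_{\hat u_{t:N-1}}\max_{(v_{t:N-1},d_{t:N-1})}L_t(x_{t:N},\hat u_{t:N-1}+d_{t:N-1})-\frac{1}{2\theta}\sum_{k=t}^{N-1}\left(v_k^\top W_k^{-1}v_k+d_k^\top\Sigma_k^{-1}d_k\right).$$ Backward Riccati recursion (for the given $\theta$): $P_N=Q_N$, $\eta_N=0$, and for $t=N-1,\ldots,0$, $$S_t=W_t^{-1}-2\theta P_{t+1},\qquad \tilde P_{t+1}=P_{t+1}+2\theta P_{t+1}S_t^{-1}P_{t+1},\qquad \tilde H_t=R_t+B_t^\top\tilde P_{t+1}B_t,$$ $$P_t=Q_t+A_t^\top\tilde P_{t+1}A_t-A_t^\top\tilde P_{t+1}B_t\tilde H_t^{-1}B_t^\top\tilde P_{t+1}A_t,\qquad \eta_t=\eta_{t+1}-\frac{1}{2\theta}\log|S_tW_t|.$$ It is well-defined if all the inverses and logarithms occurring in it exist. *)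

theory Defs
  imports "HOL-Analysis.Analysis"
begin

definition quad :: "real^'k^'k \<Rightarrow> real^'k \<Rightarrow> real" where
  "quad M x = x \<bullet> (M *v x)"

text \<open>The Loewner order compares symmetric matrices, so symmetry is part of definiteness.\<close>

definition pos_definite :: "real^'k^'k \<Rightarrow> bool" where
  "pos_definite M \<longleftrightarrow> transpose M = M \<and> (\<forall>x. x \<noteq> 0 \<longrightarrow> 0 < quad M x)"

definition pos_semidefinite :: "real^'k^'k \<Rightarrow> bool" where
  "pos_semidefinite M \<longleftrightarrow> transpose M = M \<and> (\<forall>x. 0 \<le> quad M x)"

text \<open>State space \<open>real^'n\<close>, input space \<open>real^'m\<close>. Only the entries with index below the
  horizon (up to and including the horizon for \<open>Qmat\<close>) are meaningful.\<close>

record ('n, 'm) lq_data =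
  horizon :: nat
  Amat :: "nat \<Rightarrow> real^'n^'n"
  Bmat :: "nat \<Rightarrow> real^'m^'n"
  Wmat :: "nat \<Rightarrow> real^'n^'n"
  Sigmat :: "nat \<Rightarrow> real^'m^'m"
  Rmat :: "nat \<Rightarrow> real^'m^'m"
  Qmat :: "nat \<Rightarrow> real^'n^'n"

definition lq_valid :: "('n::finite, 'm::finite) lq_data \<Rightarrow> bool" where
  "lq_valid D \<longleftrightarrow>
     0 < horizon D \<and>
     (\<forall>t<horizon D. pos_definite (Wmat D t) \<and> pos_definite (Sigmat D t) \<and> pos_definite (Rmat D t)) \<and>
     (\<forall>t\<le>horizon D. pos_semidefinite (Qmat D t))"

text \<open>\<open>riccati_recursion D \<theta> P \<eta> S Pt H\<close>: the recursion is well-defined and generates these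
  sequences; \<open>Pt t\<close> and \<open>H t\<close> stand for $\tilde P_t$ and $\tilde H_t$. Since \<open>matrix_inv\<close> and \<open>ln\<close>
  are total, existence of the inverses and logarithms is stated explicitly.\<close>

definition riccati_recursion ::
    "('n::finite, 'm::finite) lq_data \<Rightarrow> real \<Rightarrow> (nat \<Rightarrow> real^'n^'n) \<Rightarrow> (nat \<Rightarrow> real) \<Rightarrow>
     (nat \<Rightarrow> real^'n^'n) \<Rightarrow> (nat \<Rightarrow> real^'n^'n) \<Rightarrow> (nat \<Rightarrow> real^'m^'m) \<Rightarrow> bool" where
  "riccati_recursion D \<theta> P \<eta> S Pt H \<longleftrightarrow>
     P (horizon D) = Qmat D (horizon D) \<and> \<eta> (horizon D) = 0 \<and>
     (\<forall>t<horizon D.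
        invertible (Wmat D t) \<and> invertible (S t) \<and> invertible (H t) \<and> 0 < det (S t ** Wmat D t) \<and>
        S t = matrix_inv (Wmat D t) - (2 * \<theta>) *\<^sub>R P (Suc t) \<and>
        Pt (Suc t) = P (Suc t) + (2 * \<theta>) *\<^sub>R (P (Suc t) ** matrix_inv (S t) ** P (Suc t)) \<and>
        H t = Rmat D t + transpose (Bmat D t) ** Pt (Suc t) ** Bmat D t \<and>
        P t = Qmat D t + transpose (Amat D t) ** Pt (Suc t) ** Amat D t
              - transpose (Amat D t) ** Pt (Suc t) ** Bmat D t ** matrix_inv (H t)
                ** transpose (Bmat D t) ** Pt (Suc t) ** Amat D t \<and>
        \<eta> t = \<eta> (Suc t) - 1 / (2 * \<theta>) * ln (det (S t ** Wmat D t)))"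

text \<open>Strategies receive the time and the list of states observed so far, most recent state last.
  The adversary's strategies also receive the controller's current input. In the subgame
  starting at time \<open>t\<close> the list at time \<open>k\<close> is \<open>[x\<^sub>t, \<dots>, x\<^sub>k]\<close>.\<close>

type_synonym ('n, 'm) controller = "nat \<Rightarrow> (real^'n) list \<Rightarrow> real^'m"
type_synonym ('n, 'm, 'k) response = "nat \<Rightarrow> (real^'n) list \<Rightarrow> real^'m \<Rightarrow> real^'k"

definition next_state ::
    "('n::finite, 'm::finite) lq_data \<Rightarrow> nat \<Rightarrow> real^'n \<Rightarrow> real^'m \<Rightarrow> real^'n \<Rightarrow> real^'m \<Rightarrow> real^'n" where
  "next_state D t x u v d = Amat D t *v x + Bmat D t *v (u + d) + v"

text \<open>The state history after \<open>j\<close> steps of closed-loop play from state \<open>x\<close> at time \<open>t\<close>.\<close>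

primrec history ::
    "('n::finite, 'm::finite) lq_data \<Rightarrow> ('n, 'm) controller \<Rightarrow> ('n, 'm, 'n) response \<Rightarrow>
     ('n, 'm, 'm) response \<Rightarrow> nat \<Rightarrow> real^'n \<Rightarrow> nat \<Rightarrow> (real^'n) list" where
  "history D \<gamma> \<nu> \<delta> t x 0 = [x]"
| "history D \<gamma> \<nu> \<delta> t x (Suc j) =
     (let h = history D \<gamma> \<nu> \<delta> t x j; k = t + j; u = \<gamma> k h
      in h @ [next_state D k (last h) u (\<nu> k h u) (\<delta> k h u)])"

text \<open>$L_t(x_{t:N}, u_{t:N-1})$\<close>

definition lq_cost ::
    "('n::finite, 'm::finite) lq_data \<Rightarrow> nat \<Rightarrow> (nat \<Rightarrow> real^'n) \<Rightarrow> (nat \<Rightarrow> real^'m) \<Rightarrow> real" where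
  "lq_cost D t x u =
     quad (Qmat D (horizon D)) (x (horizon D))
     + (\<Sum>k\<in>{t..<horizon D}. quad (Qmat D k) (x k) + quad (Rmat D k) (u k))"

definition disturbance_cost ::
    "('n::finite, 'm::finite) lq_data \<Rightarrow> nat \<Rightarrow> real^'n \<Rightarrow> real^'m \<Rightarrow> real" where
  "disturbance_cost D k v d = quad (matrix_inv (Wmat D k)) v + quad (matrix_inv (Sigmat D k)) d"

definition payoff ::
    "('n::finite, 'm::finite) lq_data \<Rightarrow> real \<Rightarrow> nat \<Rightarrow> real^'n \<Rightarrow>
     ('n, 'm) controller \<Rightarrow> ('n, 'm, 'n) response \<Rightarrow> ('n, 'm, 'm) response \<Rightarrow> real" where
  "payoff D \<theta> t x0 \<gamma> \<nu> \<delta> =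
     (let h = (\<lambda>k. history D \<gamma> \<nu> \<delta> t x0 (k - t));
          x = (\<lambda>k. last (h k));
          u = (\<lambda>k. \<gamma> k (h k));
          v = (\<lambda>k. \<nu> k (h k) (u k));
          d = (\<lambda>k. \<delta> k (h k) (u k))
      in lq_cost D t x (\<lambda>k. u k + d k)
         - 1 / (2 * \<theta>) * (\<Sum>k\<in>{t..<horizon D}. disturbance_cost D k (v k) (d k)))"

definition saddle_point ::
    "('n::finite, 'm::finite) lq_data \<Rightarrow> real \<Rightarrow> nat \<Rightarrow> real^'n \<Rightarrow>
     ('n, 'm) controller \<Rightarrow> ('n, 'm, 'n) response \<Rightarrow> ('n, 'm, 'm) response \<Rightarrow> bool" where
  "saddle_point D \<theta> t x \<gamma> \<nu> \<delta> \<longleftrightarrow>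
     (\<forall>\<nu>' \<delta>'. payoff D \<theta> t x \<gamma> \<nu>' \<delta>' \<le> payoff D \<theta> t x \<gamma> \<nu> \<delta>) \<and>
     (\<forall>\<gamma>'. payoff D \<theta> t x \<gamma> \<nu> \<delta> \<le> payoff D \<theta> t x \<gamma>' \<nu> \<delta>)"

text \<open>Against some controller strategies the adversary's supremum is infinite or not attained, so
  the min-max value is an infimum of suprema in the extended reals. Attainment of the minimum and
  of the corresponding maximum is expressed separately by \<open>minmax_attained\<close>.\<close>

definition worst_case ::
    "('n::finite, 'm::finite) lq_data \<Rightarrow> real \<Rightarrow> nat \<Rightarrow> real^'n \<Rightarrow> ('n, 'm) controller \<Rightarrow> ereal" where
  "worst_case D \<theta> t x \<gamma> = (SUP (\<nu>, \<delta>). ereal (payoff D \<theta> t x \<gamma> \<nu> \<delta>))"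

definition minmax_value ::
    "('n::finite, 'm::finite) lq_data \<Rightarrow> real \<Rightarrow> nat \<Rightarrow> real^'n \<Rightarrow> ereal" where
  "minmax_value D \<theta> t x = (INF \<gamma>. worst_case D \<theta> t x \<gamma>)"

definition minmax_attained ::
    "('n::finite, 'm::finite) lq_data \<Rightarrow> real \<Rightarrow> nat \<Rightarrow> real^'n \<Rightarrow>
     ('n, 'm) controller \<Rightarrow> ('n, 'm, 'n) response \<Rightarrow> ('n, 'm, 'm) response \<Rightarrow> bool" where
  "minmax_attained D \<theta> t x \<gamma> \<nu> \<delta> \<longleftrightarrow>
     ereal (payoff D \<theta> t x \<gamma> \<nu> \<delta>) = worst_case D \<theta> t x \<gamma> \<and>
     worst_case D \<theta> t x \<gamma> = minmax_value D \<theta> t x"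

definition cost_to_go ::
    "('n::finite, 'm::finite) lq_data \<Rightarrow> real \<Rightarrow> nat \<Rightarrow> real^'n \<Rightarrow> ereal" where
  "cost_to_go D \<theta> t x =
     (if t < horizon D then minmax_value D \<theta> t x else ereal (quad (Qmat D (horizon D)) x))"

text \<open>The adversary's objective at time \<open>t\<close> after seeing the state \<open>x\<close> and the controller's input
  \<open>u\<close>, when the game from time \<open>t + 1\<close> on is worth its worst-case cost-to-go.\<close>

definition stage_objective ::
    "('n::finite, 'm::finite) lq_data \<Rightarrow> real \<Rightarrow> nat \<Rightarrow> real^'n \<Rightarrow> real^'m \<Rightarrow> real^'n \<Rightarrow> real^'m \<Rightarrow> ereal" where
  "stage_objective D \<theta> t x u v d =
     ereal (quad (Qmat D t) x + quad (Rmat D t) (u + d) - 1 / (2 * \<theta>) * disturbance_cost D t v d)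
     + cost_to_go D \<theta> (Suc t) (next_state D t x u v d)"

definition best_response ::
    "('n::finite, 'm::finite) lq_data \<Rightarrow> real \<Rightarrow> nat \<Rightarrow> real^'n \<Rightarrow> real^'m \<Rightarrow> real^'n \<Rightarrow> real^'m \<Rightarrow> bool" where
  "best_response D \<theta> t x u v d \<longleftrightarrow>
     (\<forall>v' d'. stage_objective D \<theta> t x u v' d' \<le> stage_objective D \<theta> t x u v d)"

end

theory Submission
  imports Defs
begin

text \<open>
  Everything rests on one exact identity for a single stage. Write \<open>y = A x + B (u + d)\<close> for the
  state before the disturbance \<open>v\<close> is added. Completing the square in \<open>v\<close>, then in the total input
  \<open>u + d\<close>, then in \<open>d\<close> turns the running reward of stage \<open>t\<close> plus \<open>quad (P (t + 1))\<close> of the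
  successor state into

  \<open>quad (P t) x + quad G (u - K x) - 1 / (2 \<theta>) * (quad \<Xi> (d - d') + quad S (v - v'))\<close>,

  where \<open>d'\<close> and \<open>v'\<close> are the claimed best responses (\<open>v'\<close> to the \<open>d\<close> actually played) and
  \<open>G = H + 2 \<theta> H \<Xi>\<^sup>-\<^sup>1 H\<close>. The square in \<open>v\<close> produces \<open>Pt\<close>, the square in \<open>u + d\<close> produces \<open>P t\<close>, and
  the square in \<open>d\<close> has the same form as the one in \<open>v\<close>, with \<open>H\<close> and \<open>\<Sigma>\<^sup>-\<^sup>1\<close> in place of \<open>P (t + 1)\<close>
  and \<open>W\<^sup>-\<^sup>1\<close>. Backward induction makes \<open>P\<close> positive semidefinite, hence also \<open>Pt\<close>, \<open>H\<close> and \<open>G\<close>.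

  Summed along a play the identity telescopes: the payoff is \<open>quad (P t) x\<close> plus nonnegative terms
  governed by the controller, minus nonnegative terms governed by the adversary
  (\<open>payoff_eq_value_plus_slack\<close>). The terms of the controller vanish for the gain \<open>K\<close>, whatever the
  adversary does, and those of the adversary vanish exactly at \<open>d'\<close>, \<open>v'\<close>, whatever the controller
  does. The saddle point, the value and the uniqueness of the best responses are read off from this.
\<close>

section \<open>Quadratic forms\<close>

lemma matrix_vector_mult_uminus_left: "(- A) *v x = - (A *v x)"
  for A :: "real^'a^'b"
  by (simp add: vec_eq_iff matrix_vector_mult_def sum_negf)

lemma inner_matrix_vector_transpose: "x \<bullet> (A *v y) = (transpose A *v x) \<bullet> y"
  for A :: "real^'a^'b"
  by (simp add: dot_lmul_matrix)

lemma inner_symmetric_matrix: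
  fixes M :: "real^'a^'a"
  assumes "transpose M = M"
  shows "x \<bullet> (M *v y) = y \<bullet> (M *v x)"
  using inner_matrix_vector_transpose[of x M y] assms by (simp add: inner_commute)

lemma quad_zero [simp]: "quad M 0 = 0"
  by (simp add: quad_def)

lemma quad_add_matrix: "quad (M + N) x = quad M x + quad N x"
  by (simp add: quad_def matrix_vector_mult_add_rdistrib inner_add_right)

lemma quad_diff_matrix: "quad (M - N) x = quad M x - quad N x"
  by (simp add: quad_def matrix_vector_mult_diff_rdistrib inner_diff_right)

lemma quad_scaleR_matrix: "quad (c *\<^sub>R M) x = c * quad M x"
  by (simp add: quad_def flip: scaleR_matrix_vector_assoc)

lemma quad_congruence: "quad (transpose A ** M ** A) x = quad M (A *v x)"
  for A :: "real^'a^'b"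
  using inner_matrix_vector_transpose[of x "transpose A" "M *v (A *v x)"]
  by (simp add: quad_def flip: matrix_vector_mul_assoc)

lemma quad_add:
  assumes "transpose M = M"
  shows "quad M (x + y) = quad M x + 2 * (x \<bullet> (M *v y)) + quad M y"
  using inner_symmetric_matrix[OF assms, of x y]
  by (simp add: quad_def matrix_vector_right_distrib inner_add_left inner_add_right)

lemma quad_diff:
  assumes "transpose M = M"
  shows "quad M (x - y) = quad M x - 2 * (x \<bullet> (M *v y)) + quad M y"
  using inner_symmetric_matrix[OF assms, of x y]
  by (simp add: quad_def matrix_vector_mult_diff_distrib inner_diff_left inner_diff_right)

lemma quad_scaleR: "quad M (c *\<^sub>R x) = c\<^sup>2 * quad M x"
  by (simp add: quad_def matrix_vector_mult_scaleR power2_eq_square)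

lemma matrix_inv_right:
  fixes M :: "real^'a^'a"
  assumes "invertible M"
  shows "M ** matrix_inv M = mat 1"
  using someI_ex[OF assms[unfolded invertible_def]] by (simp add: matrix_inv_def)

lemma matrix_inv_mult_vector:
  fixes M :: "real^'a^'a"
  assumes "invertible M"
  shows "M *v (matrix_inv M *v x) = x"
  by (simp add: matrix_vector_mul_assoc matrix_inv_right[OF assms])

lemma quad_matrix_inv:
  assumes "invertible M"
  shows "quad M (matrix_inv M *v x) = quad (matrix_inv M) x"
  by (simp add: quad_def matrix_inv_mult_vector[OF assms] inner_commute)

lemma symmetric_congruence:
  fixes A :: "real^'a^'b"
  assumes "transpose M = M"
  shows "transpose (transpose A ** M ** A) = transpose A ** M ** A"
  by (simp add: matrix_transpose_mul assms matrix_mul_assoc)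

lemma transpose_add: "transpose (A + B) = transpose A + transpose B"
  by (simp add: transpose_def vec_eq_iff)

lemma transpose_diff: "transpose (A - B) = transpose A - transpose B"
  by (simp add: transpose_def vec_eq_iff)

lemma symmetric_matrix_inv:
  fixes M :: "real^'a^'a"
  assumes "invertible M" "transpose M = M"
  shows "transpose (matrix_inv M) = matrix_inv M"
proof -
  have left: "transpose (matrix_inv M) ** M = mat 1"
    using arg_cong[OF matrix_inv_right[OF assms(1)], of transpose] assms(2)
    by (simp add: matrix_transpose_mul transpose_mat)
  have "transpose (matrix_inv M) = transpose (matrix_inv M) ** (M ** matrix_inv M)"
    by (simp add: matrix_inv_right[OF assms(1)])
  also have "\<dots> = matrix_inv M"
    by (simp add: matrix_mul_assoc left)
  finally show ?thesis .
qed

lemma pos_definite_invertible: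
  assumes "pos_definite M"
  shows "invertible M"
proof -
  have "x = 0" if "M *v x = 0" for x
    using assms that by (force simp: pos_definite_def quad_def)
  then show ?thesis
    using matrix_left_invertible_ker invertible_left_inverse by blast
qed

lemma pos_definite_quad_nonneg: "pos_definite M \<Longrightarrow> 0 \<le> quad M x"
  by (cases "x = 0") (auto simp: pos_definite_def intro: less_imp_le)

lemma pos_definite_quad_eq_0_iff: "pos_definite M \<Longrightarrow> quad M x = 0 \<longleftrightarrow> x = 0"
  by (metis pos_definite_def less_irrefl quad_zero)

lemma pos_semidefinite_add:
  "pos_semidefinite M \<Longrightarrow> pos_semidefinite N \<Longrightarrow> pos_semidefinite (M + N)"
  by (simp add: pos_semidefinite_def transpose_add quad_add_matrix)

lemma pos_semidefinite_congruence:
  fixes A :: "real^'a^'b"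
  assumes "pos_semidefinite M"
  shows "pos_semidefinite (transpose A ** M ** A)"
  using assms by (simp add: pos_semidefinite_def symmetric_congruence quad_congruence)

lemma pos_definite_imp_pos_semidefinite: "pos_definite M \<Longrightarrow> pos_semidefinite M"
  using pos_definite_quad_nonneg by (auto simp: pos_definite_def pos_semidefinite_def)

lemma pos_semidefinite_matrix_inv:
  assumes "pos_definite M"
  shows "pos_semidefinite (matrix_inv M)"
proof -
  note inv = pos_definite_invertible[OF assms]
  have "0 \<le> quad (matrix_inv M) x" for x
    using pos_definite_quad_nonneg[OF assms, of "matrix_inv M *v x"] quad_matrix_inv[OF inv, of x]
    by simp
  with assms show ?thesis
    by (simp add: pos_semidefinite_def pos_definite_def symmetric_matrix_inv[OF inv])
qed

section \<open>Completing the square\<close>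

text \<open>The adversary adds \<open>v\<close> to a point \<open>y\<close> valued by \<open>M\<close> and pays for it through \<open>C\<close>. The part
  quadratic in \<open>v\<close> is \<open>- quad (C - c M) v / c\<close>, so the optimal \<open>v\<close> is \<open>c (C - c M)\<^sup>-\<^sup>1 M y\<close>. Both
  moves of the adversary are of this kind, with \<open>c = 2 \<theta>\<close>.\<close>

lemma adversary_square:
  fixes M C :: "real^'a^'a" and c :: real
  defines "T \<equiv> C - c *\<^sub>R M"
  assumes c: "0 < c" and M: "transpose M = M" and T: "pos_definite T"
  shows "quad M (y + v) - 1 / c * quad C v
       = quad (M + c *\<^sub>R (M ** matrix_inv T ** M)) y
         - 1 / c * quad T (v - c *\<^sub>R ((matrix_inv T ** M) *v y))"
proof -
  define b where "b = M *v y"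
  note inv = pos_definite_invertible[OF T]
  have C: "quad C v = quad T v + c * quad M v"
    by (simp add: T_def quad_diff_matrix quad_scaleR_matrix)
  have cross: "y \<bullet> (M *v v) = v \<bullet> b"
    by (simp add: b_def inner_symmetric_matrix[OF M, of y v])
  have "quad (M ** matrix_inv T ** M) y = quad (matrix_inv T) b"
    using quad_congruence[of M "matrix_inv T" y] by (simp add: M b_def)
  moreover have "quad T (v - c *\<^sub>R (matrix_inv T *v b))
      = quad T v - 2 * c * (v \<bullet> b) + c\<^sup>2 * quad (matrix_inv T) b"
    using T by (simp add: pos_definite_def quad_diff quad_scaleR matrix_vector_mult_scaleR
        matrix_inv_mult_vector[OF inv] quad_matrix_inv[OF inv])
  ultimately show ?thesis
    using c
    by (simp add: quad_add[OF M] quad_add_matrix quad_scaleR_matrix C cross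
        flip: matrix_vector_mul_assoc b_def)
      (simp add: field_simps power2_eq_square)
qed

lemma pos_semidefinite_adversary_square:
  fixes M :: "real^'a^'a"
  assumes "0 < c" "pos_semidefinite M" "pos_definite T"
  shows "pos_semidefinite (M + c *\<^sub>R (M ** matrix_inv T ** M))"
proof -
  have "pos_semidefinite (M ** matrix_inv T ** M)"
    using pos_semidefinite_congruence[OF pos_semidefinite_matrix_inv[OF assms(3)], of M] assms(2)
    by (simp add: pos_semidefinite_def)
  then have "pos_semidefinite (c *\<^sub>R (M ** matrix_inv T ** M))"
    using assms(1)
    by (simp add: pos_semidefinite_def quad_scaleR_matrix transpose_scalar)
  with assms(2) show ?thesis
    by (rule pos_semidefinite_add)
qed

text \<open>The one-step linear-quadratic problem: \<open>w\<close> is the total input, and the last term measures how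
  far it is from the optimal feedback. The other quadratic form on the right is the
  Riccati update up to the state cost.\<close>

lemma controller_square:
  fixes A M :: "real^'n^'n" and B :: "real^'m^'n" and R :: "real^'m^'m"
  defines "H \<equiv> R + transpose B ** M ** B"
  defines "K \<equiv> - (matrix_inv H ** transpose B ** M ** A)"
  assumes M: "transpose M = M" and H: "transpose H = H" and inv: "invertible H"
  shows "quad R w + quad M (A *v x + B *v w)
       = quad (transpose A ** M ** A
               - transpose A ** M ** B ** matrix_inv H ** transpose B ** M ** A) x
         + quad H (w - K *v x)"
proof -
  define b where "b = transpose B *v (M *v (A *v x))"
  have Kx: "K *v x = - (matrix_inv H *v b)"
    by (simp add: K_def b_def matrix_vector_mult_uminus_left flip: matrix_vector_mul_assoc)
  have "quad H (w - K *v x) = quad H (w + matrix_inv H *v b)"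
    by (simp add: Kx)
  also have "\<dots> = quad H w + 2 * (w \<bullet> b) + quad (matrix_inv H) b"
    by (simp add: quad_add[OF H] matrix_inv_mult_vector[OF inv] quad_matrix_inv[OF inv])
  finally have square: "quad H (w - K *v x) = \<dots>" .
  have "transpose A ** M ** B ** matrix_inv H ** transpose B ** M ** A
      = transpose (transpose B ** M ** A) ** matrix_inv H ** (transpose B ** M ** A)"
    by (simp add: matrix_transpose_mul M matrix_mul_assoc)
  then have correction: "quad (transpose A ** M ** B ** matrix_inv H ** transpose B ** M ** A) x
      = quad (matrix_inv H) b"
    by (simp only: quad_congruence) (simp add: b_def flip: matrix_vector_mul_assoc)
  have cross: "(A *v x) \<bullet> (M *v (B *v w)) = w \<bullet> b"
    using inner_matrix_vector_transpose[of "M *v (A *v x)" B w]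
    by (simp add: b_def inner_commute inner_symmetric_matrix[OF M, of "A *v x"])
  show ?thesis
    by (simp add: square quad_diff_matrix quad_congruence correction quad_add[OF M] cross)
      (simp add: H_def quad_add_matrix quad_congruence)
qed

section \<open>Telescoping along a play\<close>

lemma last_history_Suc:
  fixes D :: "('n::finite, 'm::finite) lq_data" and t :: nat and x :: "real^'n"
    and \<gamma> :: "('n, 'm) controller" and \<nu> :: "('n, 'm, 'n) response" and \<delta> :: "('n, 'm, 'm) response"
  defines "h \<equiv> history D \<gamma> \<nu> \<delta> t x"
  assumes "t \<le> k"
  shows "last (h (Suc k - t)) = (let u = \<gamma> k (h (k - t))
    in next_state D k (last (h (k - t))) u (\<nu> k (h (k - t)) u) (\<delta> k (h (k - t)) u))"
  using assms by (simp add: Suc_diff_le Let_def)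

definition stage_reward ::
    "('n::finite, 'm::finite) lq_data \<Rightarrow> real \<Rightarrow> nat \<Rightarrow> real^'n \<Rightarrow> real^'m \<Rightarrow> real^'n \<Rightarrow> real^'m \<Rightarrow> real" where
  "stage_reward D \<theta> t x u v d =
     quad (Qmat D t) x + quad (Rmat D t) (u + d) - 1 / (2 * \<theta>) * disturbance_cost D t v d"

text \<open>Verification principle: for every candidate value function \<open>F\<close> with the right terminal value,
  the payoff differs from \<open>F\<close> at the initial state by the sum of the amounts by which \<open>F\<close> violates
  the dynamic programming equation along the play.\<close>

lemma payoff_eq_candidate_plus_defects:
  fixes D :: "('n::finite, 'm::finite) lq_data" and F :: "nat \<Rightarrow> real^'n \<Rightarrow> real"
  assumes t: "t \<le> horizon D"
    and terminal: "\<And>x. F (horizon D) x = quad (Qmat D (horizon D)) x"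
  shows "payoff D \<theta> t x \<gamma> \<nu> \<delta> = F t x + (\<Sum>k\<in>{t..<horizon D}.
    let h = history D \<gamma> \<nu> \<delta> t x (k - t); u = \<gamma> k h; v = \<nu> k h u; d = \<delta> k h u
    in stage_reward D \<theta> k (last h) u v d + F (Suc k) (next_state D k (last h) u v d) - F k (last h))"
proof -
  define h where "h k = history D \<gamma> \<nu> \<delta> t x (k - t)" for k
  define u where "u k = \<gamma> k (h k)" for k
  define v where "v k = \<nu> k (h k) (u k)" for k
  define d where "d k = \<delta> k (h k) (u k)" for k
  have start: "last (h t) = x"
    by (simp add: h_def)
  have step: "next_state D k (last (h k)) (u k) (v k) (d k) = last (h (Suc k))" if "t \<le> k" for k
    using last_history_Suc[OF that, of D \<gamma> \<nu> \<delta> x]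
    by (simp add: h_def u_def v_def d_def Let_def)
  have "(\<Sum>k\<in>{t..<horizon D}. F (Suc k) (last (h (Suc k))) - F k (last (h k)))
      = quad (Qmat D (horizon D)) (last (h (horizon D))) - F t x"
    using sum_Suc_diff'[OF t, of "\<lambda>k. F k (last (h k))"] by (simp add: terminal start)
  then have "payoff D \<theta> t x \<gamma> \<nu> \<delta> = F t x
      + (\<Sum>k\<in>{t..<horizon D}. stage_reward D \<theta> k (last (h k)) (u k) (v k) (d k))
      + (\<Sum>k\<in>{t..<horizon D}. F (Suc k) (last (h (Suc k))) - F k (last (h k)))"
    by (simp add: payoff_def lq_cost_def stage_reward_def Let_def h_def u_def v_def d_def
        sum.distrib sum_subtractf sum_distrib_left)
  also have "\<dots> = F t x + (\<Sum>k\<in>{t..<horizon D}. stage_reward D \<theta> k (last (h k)) (u k) (v k) (d k)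
      + F (Suc k) (next_state D k (last (h k)) (u k) (v k) (d k)) - F k (last (h k)))"
    by (simp add: step sum.distrib sum_subtractf)
  finally show ?thesis
    by (simp add: Let_def h_def u_def v_def d_def)
qed

section \<open>The Riccati recursion and the stage identity\<close>

locale riccati_game =
  fixes D :: "('n::finite, 'm::finite) lq_data"
    and \<theta> :: real
    and P S Pt :: "nat \<Rightarrow> real^'n^'n"
    and H :: "nat \<Rightarrow> real^'m^'m"
    and \<eta> :: "nat \<Rightarrow> real"
    and \<Xi> :: "nat \<Rightarrow> real^'m^'m"
    and K :: "nat \<Rightarrow> real^'n^'m"
  assumes valid: "lq_valid D"
    and \<theta>_pos: "0 < \<theta>"
    and riccati: "riccati_recursion D \<theta> P \<eta> S Pt H"
    and S_pos: "t < horizon D \<Longrightarrow> pos_definite (S t)"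
    and \<Xi>_eq: "\<Xi> t = matrix_inv (Sigmat D t) - (2 * \<theta>) *\<^sub>R H t"
    and \<Xi>_pos: "t < horizon D \<Longrightarrow> pos_definite (\<Xi> t)"
    and K_eq: "K t = - (matrix_inv (Rmat D t + transpose (Bmat D t) ** Pt (Suc t) ** Bmat D t)
                ** transpose (Bmat D t) ** Pt (Suc t) ** Amat D t)"
begin

lemma
  assumes "t < horizon D"
  shows S_eq: "S t = matrix_inv (Wmat D t) - (2 * \<theta>) *\<^sub>R P (Suc t)"
    and Pt_eq: "Pt (Suc t) = P (Suc t) + (2 * \<theta>) *\<^sub>R (P (Suc t) ** matrix_inv (S t) ** P (Suc t))"
    and H_eq: "H t = Rmat D t + transpose (Bmat D t) ** Pt (Suc t) ** Bmat D t"
    and P_eq: "P t = Qmat D t + (transpose (Amat D t) ** Pt (Suc t) ** Amat D t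
              - transpose (Amat D t) ** Pt (Suc t) ** Bmat D t ** matrix_inv (H t)
                ** transpose (Bmat D t) ** Pt (Suc t) ** Amat D t)"
    and H_invertible: "invertible (H t)"
  using riccati assms unfolding riccati_recursion_def add_diff_eq by blast+

lemma Pt_pos_semidefinite:
  assumes "t < horizon D" "pos_semidefinite (P (Suc t))"
  shows "pos_semidefinite (Pt (Suc t))"
  unfolding Pt_eq[OF assms(1)]
  using \<theta>_pos assms S_pos by (intro pos_semidefinite_adversary_square) auto

lemma H_pos_semidefinite:
  assumes "t < horizon D" "pos_semidefinite (P (Suc t))"
  shows "pos_semidefinite (H t)"
  unfolding H_eq[OF assms(1)]
  using valid assms Pt_pos_semidefinite
  by (auto simp: lq_valid_def
      intro!: pos_semidefinite_add pos_semidefinite_congruence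
      intro: pos_definite_imp_pos_semidefinite)

lemma input_square:
  assumes t: "t < horizon D" and P: "pos_semidefinite (P (Suc t))"
  shows "quad (Qmat D t) x + quad (Rmat D t) w + quad (Pt (Suc t)) (Amat D t *v x + Bmat D t *v w)
    = quad (P t) x + quad (H t) (w - K t *v x)"
proof -
  have "transpose (Pt (Suc t)) = Pt (Suc t)" "transpose (H t) = H t"
    using Pt_pos_semidefinite[OF assms] H_pos_semidefinite[OF assms]
    by (simp_all add: pos_semidefinite_def)
  then show ?thesis
    using controller_square[of "Pt (Suc t)" "Rmat D t" "Bmat D t" w "Amat D t" x] H_invertible[OF t]
    by (simp add: P_eq[OF t] K_eq quad_add_matrix flip: H_eq[OF t])
qed

text \<open>The Riccati update subtracts a matrix, and still \<open>quad (P t) x\<close> is nonnegative: it is the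
  right-hand side of \<open>input_square\<close> at \<open>w = K x\<close>, where the left-hand side is a sum of nonnegative
  terms.\<close>

lemma P_pos_semidefinite_step:
  assumes t: "t < horizon D" and P: "pos_semidefinite (P (Suc t))"
  shows "pos_semidefinite (P t)"
proof -
  note Pt = Pt_pos_semidefinite[OF assms] and H = H_pos_semidefinite[OF assms]
  have Q: "pos_semidefinite (Qmat D t)" and R: "pos_definite (Rmat D t)"
    using valid t by (simp_all add: lq_valid_def)
  have "quad (P t) x \<ge> 0" for x
    using input_square[OF assms, of x "K t *v x"] Q Pt pos_definite_quad_nonneg[OF R, of "K t *v x"]
    by (simp add: pos_semidefinite_def) (metis add_nonneg_nonneg)
  moreover have "transpose (P t) = P t"
  proof -
    let ?L = "transpose (Bmat D t) ** Pt (Suc t) ** Amat D t"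
    have Pt_sym: "transpose (Pt (Suc t)) = Pt (Suc t)"
      using Pt by (simp add: pos_semidefinite_def)
    have "transpose (matrix_inv (H t)) = matrix_inv (H t)"
      using H by (simp add: symmetric_matrix_inv[OF H_invertible[OF t]] pos_semidefinite_def)
    then have "transpose (transpose ?L ** matrix_inv (H t) ** ?L)
        = transpose ?L ** matrix_inv (H t) ** ?L"
      by (rule symmetric_congruence)
    with symmetric_congruence[OF Pt_sym, of "Amat D t"] show ?thesis
      using Q by (simp add: P_eq[OF t] transpose_add transpose_diff pos_semidefinite_def
          matrix_transpose_mul Pt_sym matrix_mul_assoc)
  qed
  ultimately show ?thesis
    by (simp add: pos_semidefinite_def)
qed

lemma P_pos_semidefinite: "t \<le> horizon D \<Longrightarrow> pos_semidefinite (P t)"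
proof (induction rule: inc_induct)
  case base
  then show ?case
    using riccati valid by (simp add: riccati_recursion_def lq_valid_def)
next
  case (step t)
  then show ?case
    by (simp add: P_pos_semidefinite_step)
qed

definition d_opt :: "nat \<Rightarrow> real^'n \<Rightarrow> real^'m \<Rightarrow> real^'m" where
  "d_opt t x u = (2 * \<theta>) *\<^sub>R ((matrix_inv (\<Xi> t) ** H t) *v (u - K t *v x))"

definition v_opt :: "nat \<Rightarrow> real^'n \<Rightarrow> real^'m \<Rightarrow> real^'m \<Rightarrow> real^'n" where
  "v_opt t x u d = (2 * \<theta>) *\<^sub>R ((matrix_inv (S t) ** P (Suc t)) *v (Amat D t *v x + Bmat D t *v (u + d)))"

definition controller_loss :: "nat \<Rightarrow> real^'n \<Rightarrow> real^'m \<Rightarrow> real" where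
  "controller_loss t x u =
     quad (H t + (2 * \<theta>) *\<^sub>R (H t ** matrix_inv (\<Xi> t) ** H t)) (u - K t *v x)"

definition adversary_loss :: "nat \<Rightarrow> real^'n \<Rightarrow> real^'m \<Rightarrow> real^'n \<Rightarrow> real^'m \<Rightarrow> real" where
  "adversary_loss t x u v d =
     1 / (2 * \<theta>) * (quad (\<Xi> t) (d - d_opt t x u) + quad (S t) (v - v_opt t x u d))"

lemma controller_loss_nonneg: "t < horizon D \<Longrightarrow> 0 \<le> controller_loss t x u"
  using pos_semidefinite_adversary_square[of "2 * \<theta>" "H t" "\<Xi> t"] \<theta>_pos \<Xi>_pos
    H_pos_semidefinite P_pos_semidefinite
  by (simp add: controller_loss_def pos_semidefinite_def)

lemma controller_loss_feedback [simp]: "controller_loss t x (K t *v x) = 0"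
  by (simp add: controller_loss_def)

lemma adversary_loss_nonneg: "t < horizon D \<Longrightarrow> 0 \<le> adversary_loss t x u v d"
  using \<theta>_pos \<Xi>_pos S_pos by (simp add: adversary_loss_def pos_definite_quad_nonneg)

lemma adversary_loss_eq_0_iff:
  assumes "t < horizon D"
  shows "adversary_loss t x u v d = 0 \<longleftrightarrow> d = d_opt t x u \<and> v = v_opt t x u (d_opt t x u)"
  using \<theta>_pos \<Xi>_pos[OF assms] S_pos[OF assms]
  by (auto simp: adversary_loss_def add_nonneg_eq_0_iff pos_definite_quad_nonneg
      pos_definite_quad_eq_0_iff)

text \<open>The three squares are completed in the order \<open>v\<close>, \<open>u + d\<close>, \<open>d\<close>. The third one starts from
  \<open>quad (H t) ((u - K x) + d)\<close>, which is what the second one leaves.\<close>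

lemma stage_identity:
  assumes t: "t < horizon D"
  shows "stage_reward D \<theta> t x u v d + quad (P (Suc t)) (next_state D t x u v d)
    = quad (P t) x + controller_loss t x u - adversary_loss t x u v d"
proof -
  define y where "y = Amat D t *v x + Bmat D t *v (u + d)"
  have P: "pos_semidefinite (P (Suc t))"
    using t by (simp add: P_pos_semidefinite)
  have c: "0 < 2 * \<theta>"
    using \<theta>_pos by simp
  have P_sym: "transpose (P (Suc t)) = P (Suc t)" and H_sym: "transpose (H t) = H t"
    using P H_pos_semidefinite[OF t P] by (simp_all add: pos_semidefinite_def)
  have v: "quad (P (Suc t)) (y + v) - 1 / (2 * \<theta>) * quad (matrix_inv (Wmat D t)) v
      = quad (Pt (Suc t)) y - 1 / (2 * \<theta>) * quad (S t) (v - v_opt t x u d)"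
    using adversary_square[OF c P_sym, of "matrix_inv (Wmat D t)" y v] S_pos[OF t]
    by (simp add: v_opt_def y_def flip: S_eq[OF t] Pt_eq[OF t])
  have w: "quad (Qmat D t) x + quad (Rmat D t) (u + d) + quad (Pt (Suc t)) y
      = quad (P t) x + quad (H t) ((u - K t *v x) + d)"
    using input_square[OF t P, of x "u + d"] by (simp add: y_def algebra_simps)
  have d: "quad (H t) ((u - K t *v x) + d) - 1 / (2 * \<theta>) * quad (matrix_inv (Sigmat D t)) d
      = controller_loss t x u - 1 / (2 * \<theta>) * quad (\<Xi> t) (d - d_opt t x u)"
    using adversary_square[OF c H_sym, of "matrix_inv (Sigmat D t)" "u - K t *v x" d] \<Xi>_pos[OF t]
    by (simp add: controller_loss_def d_opt_def flip: \<Xi>_eq)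
  have "next_state D t x u v d = y + v"
    by (simp add: next_state_def y_def)
  then show ?thesis
    using v w d
    by (simp add: stage_reward_def disturbance_cost_def adversary_loss_def distrib_left)
qed

section \<open>Value and optimal play\<close>

lemma payoff_eq_value_plus_slack:
  assumes "t \<le> horizon D"
  shows "payoff D \<theta> t x \<gamma> \<nu> \<delta> = quad (P t) x + (\<Sum>k\<in>{t..<horizon D}.
    let h = history D \<gamma> \<nu> \<delta> t x (k - t); u = \<gamma> k h
    in controller_loss k (last h) u - adversary_loss k (last h) u (\<nu> k h u) (\<delta> k h u))"
proof -
  have "P (horizon D) = Qmat D (horizon D)"
    using riccati by (simp add: riccati_recursion_def)
  with payoff_eq_candidate_plus_defects[of t D "\<lambda>k. quad (P k)"] assms show ?thesis
    by (auto simp: stage_identity Let_def intro!: sum.cong)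
qed

definition u_star :: "('n, 'm) controller" where
  "u_star t h = K t *v last h"

definition d_star :: "('n, 'm, 'm) response" where
  "d_star t h u = d_opt t (last h) u"

definition v_star :: "('n, 'm, 'n) response" where
  "v_star t h u = v_opt t (last h) u (d_star t h u)"

lemma adversary_loss_star [simp]:
  "t < horizon D \<Longrightarrow> adversary_loss t (last h) u (v_star t h u) (d_star t h u) = 0"
  by (simp add: adversary_loss_eq_0_iff v_star_def d_star_def)

lemma payoff_controller_optimal:
  "t \<le> horizon D \<Longrightarrow> payoff D \<theta> t x u_star \<nu> \<delta> \<le> quad (P t) x"
  by (auto simp: payoff_eq_value_plus_slack Let_def u_star_def adversary_loss_nonneg
      intro!: sum_nonpos)

lemma payoff_adversary_optimal:
  "t \<le> horizon D \<Longrightarrow> quad (P t) x \<le> payoff D \<theta> t x \<gamma> v_star d_star"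
  by (auto simp: payoff_eq_value_plus_slack Let_def controller_loss_nonneg intro!: sum_nonneg)

lemma payoff_star: "t \<le> horizon D \<Longrightarrow> payoff D \<theta> t x u_star v_star d_star = quad (P t) x"
  by (intro antisym payoff_controller_optimal payoff_adversary_optimal)

lemma saddle_point_star: "t \<le> horizon D \<Longrightarrow> saddle_point D \<theta> t x u_star v_star d_star"
  by (simp add: saddle_point_def payoff_star payoff_controller_optimal payoff_adversary_optimal)

lemma worst_case_u_star:
  assumes "t \<le> horizon D"
  shows "worst_case D \<theta> t x u_star = ereal (quad (P t) x)"
  unfolding worst_case_def
proof (rule antisym)
  show "(SUP (\<nu>, \<delta>). ereal (payoff D \<theta> t x u_star \<nu> \<delta>)) \<le> ereal (quad (P t) x)"
    using assms by (auto intro!: SUP_least payoff_controller_optimal)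
  show "ereal (quad (P t) x) \<le> (SUP (\<nu>, \<delta>). ereal (payoff D \<theta> t x u_star \<nu> \<delta>))"
    using assms by (intro SUP_upper2[of "(v_star, d_star)"]) (simp_all add: payoff_star)
qed

lemma minmax_value_eq:
  assumes "t \<le> horizon D"
  shows "minmax_value D \<theta> t x = ereal (quad (P t) x)"
  unfolding minmax_value_def
proof (rule antisym)
  show "(INF \<gamma>. worst_case D \<theta> t x \<gamma>) \<le> ereal (quad (P t) x)"
    using assms by (intro INF_lower2[of u_star]) (simp_all add: worst_case_u_star)
  show "ereal (quad (P t) x) \<le> (INF \<gamma>. worst_case D \<theta> t x \<gamma>)"
    unfolding worst_case_def
    using assms
    by (intro INF_greatest SUP_upper2[of "(v_star, d_star)"]) (simp_all add: payoff_adversary_optimal)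
qed

lemma minmax_attained_star: "t \<le> horizon D \<Longrightarrow> minmax_attained D \<theta> t x u_star v_star d_star"
  by (simp add: minmax_attained_def worst_case_u_star minmax_value_eq payoff_star)

lemma cost_to_go_eq: "t \<le> horizon D \<Longrightarrow> cost_to_go D \<theta> t x = ereal (quad (P t) x)"
  using riccati by (auto simp: cost_to_go_def minmax_value_eq riccati_recursion_def)

lemma best_response_iff:
  assumes t: "t < horizon D"
  shows "best_response D \<theta> t (last h) u v d \<longleftrightarrow> v = v_star t h u \<and> d = d_star t h u"
proof -
  have obj: "stage_objective D \<theta> t (last h) u v d
      = ereal (quad (P t) (last h) + controller_loss t (last h) u - adversary_loss t (last h) u v d)"
    for v d
    using t by (simp add: stage_objective_def cost_to_go_eq stage_reward_def flip: stage_identity)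
  have "best_response D \<theta> t (last h) u v d \<longleftrightarrow> adversary_loss t (last h) u v d = 0"
  proof
    assume "best_response D \<theta> t (last h) u v d"
    then have "stage_objective D \<theta> t (last h) u (v_star t h u) (d_star t h u)
        \<le> stage_objective D \<theta> t (last h) u v d"
      by (simp add: best_response_def)
    then show "adversary_loss t (last h) u v d = 0"
      using adversary_loss_nonneg[OF t, of "last h" u v d] by (simp add: obj t)
  next
    assume "adversary_loss t (last h) u v d = 0"
    then show "best_response D \<theta> t (last h) u v d"
      using adversary_loss_nonneg[OF t] by (simp add: best_response_def obj)
  qed
  then show ?thesis
    by (auto simp: adversary_loss_eq_0_iff[OF t] v_star_def d_star_def)
qed

text \<open>If the controller deviates only at time \<open>t\<close>, its loss is incurred at the fixed initial state
  \<open>x\<close>. That loss is the same against every adversary, so the adversary can only add losses of its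
  own.\<close>

lemma payoff_deviation_le:
  assumes t: "t < horizon D"
  shows "payoff D \<theta> t x (u_star(t := (\<lambda>_. u))) \<nu> \<delta>
    \<le> payoff D \<theta> t x (u_star(t := (\<lambda>_. u))) v_star d_star"
proof -
  let ?\<gamma> = "u_star(t := (\<lambda>_. u))"
  have loss: "controller_loss k (last h) (?\<gamma> k h) = (if k = t then controller_loss t x u else 0)"
    if "h = history D ?\<gamma> \<nu> \<delta> t x (k - t)" for k h \<nu> \<delta>
    using that by (simp add: u_star_def)
  show ?thesis
    using t unfolding payoff_eq_value_plus_slack[OF less_imp_le[OF t]] Let_def
    by (intro add_left_mono sum_mono) (simp add: loss[OF refl] adversary_loss_nonneg del: fun_upd_apply)
qed

lemma d_star_u_star: "d_star t h (u_star t h) = 0"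
  by (simp add: d_star_def d_opt_def u_star_def)

end

theorem theorem2:
  fixes D :: "('n::finite, 'm::finite) lq_data"
    and \<theta> :: real
    and x_ini :: "real^'n"
    and P S Pt :: "nat \<Rightarrow> real^'n^'n"
    and H \<Xi> :: "nat \<Rightarrow> real^'m^'m"
    and \<eta> :: "nat \<Rightarrow> real"
    and K :: "nat \<Rightarrow> real^'n^'m"
    and u_star :: "('n, 'm) controller"
    and v_star :: "('n, 'm, 'n) response"
    and d_star :: "('n, 'm, 'm) response"
  assumes "lq_valid D"
    and "0 < \<theta>"
    and "riccati_recursion D \<theta> P \<eta> S Pt H"
    and "\<And>t. t < horizon D \<Longrightarrow> pos_definite (S t)"
    and "\<And>t. \<Xi> t = matrix_inv (Sigmat D t) - (2 * \<theta>) *\<^sub>R H t"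
    and "\<And>t. t < horizon D \<Longrightarrow> pos_definite (\<Xi> t)"
    and "\<And>t. K t = - (matrix_inv (Rmat D t + transpose (Bmat D t) ** Pt (Suc t) ** Bmat D t)
                ** transpose (Bmat D t) ** Pt (Suc t) ** Amat D t)"
    and "\<And>t h. u_star t h = K t *v last h"
    and "\<And>t h u. d_star t h u = (2 * \<theta>) *\<^sub>R ((matrix_inv (\<Xi> t) ** H t) *v (u - K t *v last h))"
    and "\<And>t h u. v_star t h u = (2 * \<theta>) *\<^sub>R ((matrix_inv (S t) ** P (Suc t))
                *v (Amat D t *v last h + Bmat D t *v (u + d_star t h u)))"
  shows "saddle_point D \<theta> 0 x_ini u_star v_star d_star
    \<and> (\<forall>t<horizon D. \<forall>x. minmax_attained D \<theta> t x u_star v_star d_star)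
    \<and> (\<forall>t<horizon D. \<forall>h u v d. h \<noteq> [] \<longrightarrow>
         (best_response D \<theta> t (last h) u v d \<longleftrightarrow> v = v_star t h u \<and> d = d_star t h u))
    \<and> (\<forall>t<horizon D. \<forall>x u \<nu> \<delta>.
         payoff D \<theta> t x (u_star(t := (\<lambda>_. u))) \<nu> \<delta>
           \<le> payoff D \<theta> t x (u_star(t := (\<lambda>_. u))) v_star d_star)
    \<and> (\<forall>t<horizon D. \<forall>h u. h \<noteq> [] \<longrightarrow> u = u_star t h \<longrightarrow> d_star t h u = 0)
    \<and> (\<forall>t\<le>horizon D. \<forall>x. cost_to_go D \<theta> t x = ereal (quad (P t) x))"
proof -
  interpret G: riccati_game D \<theta> P S Pt H \<eta> \<Xi> K
    using assms(1-7) by unfold_locales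
  have u: "u_star = G.u_star"
    by (intro ext) (simp add: assms(8) G.u_star_def)
  have d: "d_star = G.d_star"
    by (intro ext) (simp add: assms(9) G.d_star_def G.d_opt_def)
  have v: "v_star = G.v_star"
    by (intro ext) (simp only: assms(10) G.v_star_def G.v_opt_def d)
  show ?thesis
    unfolding u d v
    by (auto simp: G.saddle_point_star G.minmax_attained_star G.best_response_iff
        G.d_star_u_star G.cost_to_go_eq intro: G.payoff_deviation_le)
qed

end
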